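(* Let $n\ge 2$ and let $A=(a_{ij})\in\mathbb{M}(n)$ be a nonnegative symmetric matrix with eigenvalues arranged as $\lambda_1(A)\le\lambda_2(A)\le\dots\le\lambda_n(A)$. For $1\le j\le n$ let $b_{jj}$ denote the $j$-th smallest diagonal entry of $A$. Then $$\sum_{i=2}^{n-1}\lambda_i(A)\le\sum_{i=3}^{n}b_{ii}$$ and $$\lambda_1(A)+\lambda_n(A)\ge b_{11}+b_{22}.$$
   Context: $\mathbb{M}(n)$ is the algebra of all $n\times n$ complex matrices. A matrix $A=(a_{ij})$ is nonnegative if $a_{ij}\ge 0$ for all $i,j$ (entrywise). The "$j$-th smallest diagonal entry" is counted with multiplicity, i.e. $b_{11}\le b_{22}\le\dots\le b_{nn}$ is the nondecreasing rearrangement of $a_{11},\dots,a_{nn}$. Empty sums are $0$. *)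

theory Defs
  imports
    "Jordan_Normal_Form.Char_Poly"
    "HOL-Library.Complex_Order"
begin

text \<open>
  Nonnegativity of a complex entry is stated with the order of
  \<^theory>\<open>HOL-Library.Complex_Order\<close>, in which \<open>0 \<le> z\<close> means that \<open>z\<close> is real and \<open>Re z \<ge> 0\<close>.
\<close>

definition nonnegative_mat :: "complex mat \<Rightarrow> bool" where
  "nonnegative_mat A \<longleftrightarrow> (\<forall>i<dim_row A. \<forall>j<dim_col A. 0 \<le> A $$ (i, j))"

definition symmetric_mat :: "complex mat \<Rightarrow> bool" where
  "symmetric_mat A \<longleftrightarrow> transpose_mat A = A"

text \<open>
  The \<open>j\<close>-th smallest eigenvalue, \<open>j\<close> running from 1 to the dimension. Eigenvalues are
  counted with algebraic multiplicity, as the complex roots of the characteristic polynomial.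
  The definition is meant for matrices with real spectrum (such as real symmetric ones),
  where \<open>Re\<close> only changes the type.
\<close>

definition eigval :: "complex mat \<Rightarrow> nat \<Rightarrow> real" where
  "eigval A j = sorted_list_of_multiset (image_mset Re (proots (char_poly A))) ! (j - 1)"

text \<open>
  The \<open>j\<close>-th smallest diagonal entry, counted with multiplicity, \<open>j\<close> running from 1 to the
  dimension; meant for matrices with real diagonal.
\<close>

definition sorted_diag :: "complex mat \<Rightarrow> nat \<Rightarrow> real" where
  "sorted_diag A j = sort (map Re (diag_mat A)) ! (j - 1)"

end

theory Submission
  imports
    Defs
    "HOL-Analysis.Function_Topology"
    "HOL-Combinatorics.List_Permutation"
    "Jordan_Normal_Form.Schur_Decomposition"
begin

text \<open>
  The trace of \<open>A\<close> is both the sum of its eigenvalues and the sum of its diagonal entries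
  (\<open>sum_list_diag_eq_sum_proots\<close>), so the two claimed inequalities are equivalent: each is
  the difference of that identity and the other one. What has to be shown is
  \<open>\<lambda>\<^sub>1 + \<lambda>\<^sub>n \<ge> b\<^sub>1 + b\<^sub>2\<close>.

  Take a real unit eigenvector \<open>x\<close> for \<open>\<lambda>\<^sub>1\<close> and suppose that it has entries of both signs.
  Write \<open>x = p - q\<close> with its positive and negative parts \<open>p\<close> and \<open>q\<close>, and let \<open>u\<close> and \<open>v\<close> be
  their normalisations. These are orthonormal, and the plane they span contains a
  unit vector \<open>y\<close> orthogonal to \<open>x\<close>. Since the trace of a form on a plane does not depend on the
  orthonormal basis, \<open>\<langle>x, Ax\<rangle> + \<langle>y, Ay\<rangle> = \<langle>u, Au\<rangle> + \<langle>v, Av\<rangle>\<close>. The left side is at most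
  \<open>\<lambda>\<^sub>1 + \<lambda>\<^sub>n\<close>. On the right, \<open>u\<close> and \<open>v\<close> are nonnegative vectors, so dropping the nonnegative
  off-diagonal terms leaves a weighted mean of the \<open>a\<^sub>i\<^sub>i\<close> over the support of \<open>u\<close> plus one over
  the support of \<open>v\<close>. The supports are disjoint, so this is at least \<open>a\<^sub>i\<^sub>i + a\<^sub>j\<^sub>j\<close> for some
  \<open>i \<noteq> j\<close>, hence at least \<open>b\<^sub>1 + b\<^sub>2\<close>. If the entries of \<open>x\<close> have only one sign, then
  dropping off-diagonal terms gives \<open>\<lambda>\<^sub>1 \<ge> b\<^sub>1\<close> at once, and \<open>\<lambda>\<^sub>n\<close> is at least every diagonal
  entry. This is \<open>two_diag_entries_le\<close>.

  The spectral theory used is small. That \<open>\<langle>z, Az\<rangle> \<le> \<lambda>\<^sub>n \<langle>z, z\<rangle>\<close> follows because the Rayleigh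
  quotient attains its maximum on the compact unit sphere (\<open>rayleigh_attains_max\<close>) and a
  maximiser is an eigenvector (\<open>rayleigh_max_eigenvector\<close>), so the maximum is itself a root of the
  characteristic polynomial. Conversely, the real part of any complex root is a Rayleigh quotient
  of a real vector (\<open>char_poly_root_rayleigh\<close>), which provides \<open>x\<close>.
\<close>

section \<open>Real quadratic forms\<close>

text \<open>
  Vectors are functions on \<^typ>\<open>nat\<close> of which only the values below \<open>n\<close> matter. Unlike vectors
  with an explicit dimension, they carry the product topology, which supplies compactness.
\<close>

definition dot :: "nat \<Rightarrow> (nat \<Rightarrow> real) \<Rightarrow> (nat \<Rightarrow> real) \<Rightarrow> real" where
  "dot n x y = (\<Sum>i<n. x i * y i)"

definition app :: "nat \<Rightarrow> (nat \<Rightarrow> nat \<Rightarrow> real) \<Rightarrow> (nat \<Rightarrow> real) \<Rightarrow> nat \<Rightarrow> real" where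
  "app n a x i = (\<Sum>j<n. a i j * x j)"

definition symmetric_coeffs :: "nat \<Rightarrow> (nat \<Rightarrow> nat \<Rightarrow> real) \<Rightarrow> bool" where
  "symmetric_coeffs n a \<longleftrightarrow> (\<forall>i<n. \<forall>j<n. a i j = a j i)"

lemma dot_commute: "dot n x y = dot n y x"
  by (simp add: dot_def mult.commute)

lemma dot_lincomb_left:
  "dot n (\<lambda>i. r * x i + s * y i) z = r * dot n x z + s * dot n y z"
  by (simp add: dot_def sum.distrib sum_distrib_left algebra_simps)

lemma dot_lincomb_right:
  "dot n z (\<lambda>i. r * x i + s * y i) = r * dot n z x + s * dot n z y"
  by (simp add: dot_def sum.distrib sum_distrib_left algebra_simps)

lemma app_lincomb:
  "app n a (\<lambda>i. r * x i + s * y i) = (\<lambda>i. r * app n a x i + s * app n a y i)"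
  by (simp add: app_def sum.distrib sum_distrib_left algebra_simps fun_eq_iff)

lemma dot_self_nonneg: "0 \<le> dot n x x"
  by (simp add: dot_def sum_nonneg)

lemma dot_self_pos: "i < n \<Longrightarrow> x i \<noteq> 0 \<Longrightarrow> 0 < dot n x x"
  unfolding dot_def
  by (rule sum_pos2[of _ i]) (auto simp: zero_less_mult_iff linorder_neq_iff)

lemma dot_app_commute:
  assumes "symmetric_coeffs n a"
  shows "dot n x (app n a y) = dot n y (app n a x)"
proof -
  have "dot n x (app n a y) = (\<Sum>i<n. \<Sum>j<n. a i j * x i * y j)"
    by (simp add: dot_def app_def sum_distrib_left algebra_simps)
  also have "\<dots> = (\<Sum>j<n. \<Sum>i<n. a i j * x i * y j)"
    by (rule sum.swap)
  also have "\<dots> = (\<Sum>j<n. \<Sum>i<n. a j i * x i * y j)"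
    using assms by (intro sum.cong) (auto simp: symmetric_coeffs_def)
  also have "\<dots> = dot n y (app n a x)"
    by (simp add: dot_def app_def sum_distrib_left algebra_simps)
  finally show ?thesis .
qed

text \<open>
  The two mixed terms of the expansion agree by symmetry. Perturbation of a maximiser and the
  comparison on the plane spanned by two vectors both rest on this formula.
\<close>

lemma dot_app_lincomb:
  assumes "symmetric_coeffs n a"
  shows "dot n (\<lambda>i. r * x i + s * y i) (app n a (\<lambda>i. r * x i + s * y i))
    = r\<^sup>2 * dot n x (app n a x) + s\<^sup>2 * dot n y (app n a y) + 2 * r * s * dot n x (app n a y)"
  using dot_app_commute[OF assms, of y x]
  by (simp add: app_lincomb dot_lincomb_left dot_lincomb_right power2_eq_square algebra_simps)

section \<open>The largest Rayleigh quotient is an eigenvalue\<close>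

text \<open>
  The box constraint on all coordinates, including those from \<open>n\<close> on, makes the set compact by
  Tychonoff's theorem; it excludes no unit vector up to irrelevant coordinates.
\<close>

lemma compact_unit_sphere:
  "compact {x. (\<forall>i. x i \<in> {-1..1::real}) \<and> dot n x x = 1}"
proof -
  have "compactin (product_topology (\<lambda>i. euclidean) UNIV)
      (PiE UNIV (\<lambda>i::nat. {-1..1::real}))"
    by (subst compactin_PiE) simp
  then have box: "compact (PiE UNIV (\<lambda>i::nat. {-1..1::real}))"
    by (simp add: euclidean_product_topology)
  have "closed {x. dot n x x = 1}"
    unfolding dot_def
    by (intro closed_Collect_eq continuous_intros) auto
  with box have "compact (PiE UNIV (\<lambda>i::nat. {-1..1::real}) \<inter> {x. dot n x x = 1})"
    by (rule compact_Int_closed)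
  moreover have "PiE UNIV (\<lambda>i::nat. {-1..1::real}) \<inter> {x. dot n x x = 1}
      = {x. (\<forall>i. x i \<in> {-1..1::real}) \<and> dot n x x = 1}"
    by (auto simp: PiE_UNIV_domain)
  ultimately show ?thesis by simp
qed

lemma rayleigh_attains_max:
  assumes "0 < n"
  obtains x where "dot n x x = 1"
    and "\<And>z. dot n z (app n a z) \<le> dot n x (app n a x) * dot n z z"
proof -
  let ?S = "{x. (\<forall>i. x i \<in> {-1..1::real}) \<and> dot n x x = 1}"
  have "(\<lambda>i. if i = 0 then 1 else 0) \<in> ?S"
    using assms by (auto simp: dot_def if_distrib cong: if_cong)
  then have "?S \<noteq> {}" by (metis empty_iff)
  moreover have "continuous_on ?S (\<lambda>x. dot n x (app n a x))"
    unfolding dot_def app_def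
    by (intro continuous_intros continuous_on_subset[OF continuous_on_product_coordinates]) auto
  ultimately have "\<exists>x\<in>?S. \<forall>z\<in>?S. dot n z (app n a z) \<le> dot n x (app n a x)"
    by (rule continuous_attains_sup[OF compact_unit_sphere])
  then obtain x where x: "x \<in> ?S"
    and max: "\<And>z. z \<in> ?S \<Longrightarrow> dot n z (app n a z) \<le> dot n x (app n a x)"
    by blast
  have "dot n z (app n a z) \<le> dot n x (app n a x) * dot n z z" for z
  proof (cases "\<exists>i<n. z i \<noteq> 0")
    case False
    then show ?thesis by (simp add: dot_def)
  next
    case True
    then have pos: "0 < dot n z z" using dot_self_pos by blast
    define c where "c = 1 / sqrt (dot n z z)"
    have c2: "c\<^sup>2 = 1 / dot n z z"
      using pos by (simp add: c_def power_divide)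
    \<comment> \<open>Coordinates from \<open>n\<close> on may be large in \<open>z\<close>; they are cut off to land in the box.\<close>
    define w where "w i = (if i < n then c * z i else 0)" for i
    have ww: "dot n w w = c\<^sup>2 * dot n z z"
      by (simp add: w_def dot_def sum_distrib_left power2_eq_square algebra_simps)
    then have w1: "dot n w w = 1" using c2 pos by simp
    have "(w i)\<^sup>2 \<le> 1" if "i < n" for i
    proof -
      have "w i * w i \<le> (\<Sum>i<n. w i * w i)"
        using that by (intro member_le_sum) auto
      then show ?thesis using w1 by (simp add: dot_def power2_eq_square)
    qed
    then have "\<bar>w i\<bar> \<le> 1" for i
      by (cases "i < n") (auto simp: abs_square_le_1 w_def)
    then have "w \<in> ?S" using w1 by (auto simp: abs_le_iff minus_le_iff)
    then have "dot n w (app n a w) \<le> dot n x (app n a x)" by (rule max)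
    moreover have "dot n w (app n a w) = c\<^sup>2 * dot n z (app n a z)"
      by (simp add: w_def dot_def app_def sum_distrib_left power2_eq_square algebra_simps)
    ultimately show ?thesis using c2 pos by (simp add: field_simps)
  qed
  with x show ?thesis using that by blast
qed

text \<open>
  The first-order condition at a maximum: moving from \<open>x\<close> in the direction of the residual
  \<open>w = Ax - cx\<close> changes \<open>\<langle>z, Az\<rangle> - c\<langle>z, z\<rangle>\<close> at first order by \<open>2 t \<langle>w, w\<rangle>\<close>, which would be
  positive for small \<open>t > 0\<close> unless \<open>w\<close> vanishes.
\<close>

lemma rayleigh_max_eigenvector:
  assumes sym: "symmetric_coeffs n a"
    and x: "dot n x x = 1"
    and max: "\<And>z. dot n z (app n a z) \<le> c * dot n z z"
    and c: "c = dot n x (app n a x)"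
    and i: "i < n"
  shows "app n a x i = c * x i"
proof (rule ccontr)
  assume neq: "app n a x i \<noteq> c * x i"
  define w where "w i = 1 * app n a x i + (- c) * x i" for i
  define d where "d = dot n w w"
  have d: "0 < d" unfolding d_def using neq i by (intro dot_self_pos[of i]) (auto simp: w_def)
  have dw: "dot n w (app n a x) - c * dot n w x = d"
  proof -
    have "dot n w (\<lambda>i. 1 * app n a x i + (- c) * x i) = d"
      by (simp add: d_def w_def[abs_def])
    then show ?thesis unfolding dot_lincomb_right by simp
  qed
  define e where "e = dot n w (app n a w) - c * d"
  have perturb: "2 * t * d + t\<^sup>2 * e \<le> 0" for t
  proof -
    have "dot n (\<lambda>i. 1 * x i + t * w i) (app n a (\<lambda>i. 1 * x i + t * w i))
        \<le> c * dot n (\<lambda>i. 1 * x i + t * w i) (\<lambda>i. 1 * x i + t * w i)"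
      by (rule max)
    then have "c + t\<^sup>2 * dot n w (app n a w) + 2 * t * dot n w (app n a x)
        \<le> c * (1 + 2 * t * dot n w x + t\<^sup>2 * d)"
      unfolding dot_app_lincomb[OF sym]
      using dot_app_commute[OF sym, of x w] dot_commute[of n x w]
      unfolding dot_lincomb_left dot_lincomb_right c[symmetric] x d_def
      by (simp add: algebra_simps power2_eq_square)
    moreover have "dot n w (app n a x) = d + c * dot n w x" using dw by simp
    ultimately show ?thesis by (simp add: e_def algebra_simps)
  qed
  \<comment> \<open>A step small enough for \<open>t * \<bar>e\<bar> < d\<close>, so that the linear term outweighs the quadratic one.\<close>
  define t where "t = d / (\<bar>e\<bar> + 1)"
  have "t * (2 * d + t * e) \<le> 0"
    using perturb[of t] by (simp add: power2_eq_square algebra_simps)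
  moreover have t: "0 < t" using d by (simp add: t_def add_nonneg_pos)
  ultimately have "2 * d + t * e \<le> 0" by (simp add: mult_le_0_iff)
  moreover have "t * (\<bar>e\<bar> + 1) = d" by (simp add: t_def add_nonneg_eq_0_iff)
  then have "t * \<bar>e\<bar> + t = d" by (simp add: distrib_left)
  moreover have "- (t * \<bar>e\<bar>) \<le> t * e"
    using mult_left_mono[of "- \<bar>e\<bar>" e t] t by simp
  ultimately show False using t d by linarith
qed

section \<open>Nonnegative coefficients\<close>

text \<open>
  If the entries of \<open>x\<close> do not have opposite signs, then every off-diagonal term of the form is
  nonnegative and can be dropped. Only diagonal entries on the support of \<open>x\<close> then remain.
\<close>

lemma diag_lower_bound:
  assumes nonneg: "\<And>i j. i < n \<Longrightarrow> j < n \<Longrightarrow> 0 \<le> a i j"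
    and sign: "\<And>i j. i < n \<Longrightarrow> j < n \<Longrightarrow> 0 \<le> x i * x j"
    and c: "\<And>i. i < n \<Longrightarrow> x i \<noteq> 0 \<Longrightarrow> c \<le> a i i"
  shows "c * dot n x x \<le> dot n x (app n a x)"
proof -
  have "c * dot n x x = (\<Sum>i<n. c * (x i * x i))"
    by (simp add: dot_def sum_distrib_left)
  also have "\<dots> \<le> (\<Sum>i<n. x i * app n a x i)"
  proof (rule sum_mono)
    fix i assume "i \<in> {..<n}"
    then have i: "i < n" by simp
    have "c * (x i * x i) \<le> a i i * (x i * x i)"
      using c[OF i] by (cases "x i = 0") (auto intro!: mult_right_mono)
    also have "\<dots> \<le> (\<Sum>j<n. a i j * (x i * x j))"
      using i nonneg sign by (intro member_le_sum[of i]) auto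
    also have "\<dots> = x i * app n a x i"
      by (simp add: app_def sum_distrib_left algebra_simps)
    finally show "c * (x i * x i) \<le> x i * app n a x i" .
  qed
  finally show ?thesis by (simp add: dot_def)
qed

lemma exists_argmin:
  fixes f :: "nat \<Rightarrow> real"
  assumes "finite S" "S \<noteq> {}"
  shows "\<exists>k\<in>S. \<forall>i\<in>S. f k \<le> f i"
  using assms by (meson arg_min_if_finite linorder_not_le)

text \<open>
  The heart of the argument. For \<open>x\<close> with entries of both signs, the bound \<open>c\<close> is tested on the
  unit vector \<open>y\<close> orthogonal to \<open>x\<close> in the plane of its positive and negative parts, so
  that the mixed terms of \<open>x\<close> and \<open>y\<close> cancel.
\<close>

lemma two_diag_entries_le:
  assumes sym: "symmetric_coeffs n a"
    and n: "2 \<le> n"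
    and nonneg: "\<And>i j. i < n \<Longrightarrow> j < n \<Longrightarrow> 0 \<le> a i j"
    and bound: "\<And>z. dot n z (app n a z) \<le> c * dot n z z"
    and x: "dot n x x = 1"
  shows "\<exists>i<n. \<exists>j<n. i \<noteq> j \<and> a i i + a j j \<le> dot n x (app n a x) + c"
proof (cases "(\<exists>i<n. 0 < x i) \<and> (\<exists>i<n. x i < 0)")
  case True
  define p where "p i = max (x i) 0" for i
  define q where "q i = max (- x i) 0" for i
  define P where "P = dot n p p"
  define Q where "Q = dot n q q"
  define U where "U = dot n p (app n a p)"
  define V where "V = dot n q (app n a q)"
  from True obtain i0 j0 where "i0 < n" "0 < x i0" "j0 < n" "x j0 < 0" by blast
  then have P: "0 < P" and Q: "0 < Q"
    using dot_self_pos[of i0 n p] dot_self_pos[of j0 n q] by (simp_all add: P_def Q_def p_def q_def)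
  have pq: "dot n p q = 0"
    unfolding dot_def by (intro sum.neutral) (auto simp: p_def q_def max_def)
  have x_eq: "x = (\<lambda>i. 1 * p i + (- 1) * q i)"
    by (auto simp: p_def q_def max_def)
  have PQ: "P + Q = 1"
  proof -
    have "dot n x x = P + Q"
      unfolding x_eq dot_lincomb_left dot_lincomb_right P_def Q_def
      using pq dot_commute[of n p q] by simp
    with x show ?thesis by simp
  qed
  \<comment> \<open>With \<open>r\<^sup>2 = Q / P\<close> and \<open>s = 1 / r\<close>, the vector \<open>r p + s q\<close> is \<open>p\<close> and \<open>q\<close> normalised and
      weighted with each other's norm. The mixed coefficient \<open>2 r s = 2\<close> is opposite to the one
      of \<open>p - q\<close>.\<close>
  define r where "r = sqrt (Q / P)"
  define s where "s = sqrt (P / Q)"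
  have r2: "r\<^sup>2 = Q / P" and s2: "s\<^sup>2 = P / Q"
    using P Q by (simp_all add: r_def s_def)
  have rs: "r * s = 1"
    using P Q by (simp add: r_def s_def flip: real_sqrt_mult)
  define y where "y = (\<lambda>i. r * p i + s * q i)"
  have "dot n y y = r\<^sup>2 * P + s\<^sup>2 * Q"
    unfolding y_def dot_lincomb_left dot_lincomb_right P_def Q_def
    using pq dot_commute[of n p q] by (simp add: power2_eq_square)
  then have "dot n y y = 1" using r2 s2 P Q PQ by simp
  with bound[of y] have "dot n y (app n a y) \<le> c" by simp
  moreover have "dot n y (app n a y) = r\<^sup>2 * U + s\<^sup>2 * V + 2 * dot n p (app n a q)"
    unfolding y_def dot_app_lincomb[OF sym] U_def V_def using rs by simp
  moreover have "dot n x (app n a x) = U + V - 2 * dot n p (app n a q)"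
    by (subst (1 2) x_eq, subst dot_app_lincomb[OF sym]) (simp add: U_def V_def)
  moreover have "1 + r\<^sup>2 = 1 / P" "1 + s\<^sup>2 = 1 / Q"
    using r2 s2 P Q PQ by (simp_all add: field_simps)
  then have "(1 + r\<^sup>2) * U + (1 + s\<^sup>2) * V = U / P + V / Q" by simp
  then have "U + r\<^sup>2 * U + (V + s\<^sup>2 * V) = U / P + V / Q" by (simp only: distrib_right mult_1)
  ultimately have main: "U / P + V / Q \<le> dot n x (app n a x) + c" by linarith
  obtain i where i: "i \<in> {i. i < n \<and> 0 < x i}"
    and mini: "\<And>k. k \<in> {i. i < n \<and> 0 < x i} \<Longrightarrow> a i i \<le> a k k"
    using exists_argmin[of "{i. i < n \<and> 0 < x i}" "\<lambda>i. a i i"] True by auto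
  obtain j where j: "j \<in> {i. i < n \<and> x i < 0}"
    and minj: "\<And>k. k \<in> {i. i < n \<and> x i < 0} \<Longrightarrow> a j j \<le> a k k"
    using exists_argmin[of "{i. i < n \<and> x i < 0}" "\<lambda>i. a i i"] True by auto
  have "a i i * P \<le> U" unfolding P_def U_def
    using nonneg mini by (intro diag_lower_bound) (auto simp: p_def max_def split: if_splits)
  moreover have "a j j * Q \<le> V" unfolding Q_def V_def
    using nonneg minj by (intro diag_lower_bound) (auto simp: q_def max_def split: if_splits)
  ultimately have "a i i \<le> U / P" "a j j \<le> V / Q"
    using P Q by (simp_all add: pos_le_divide_eq)
  with main have "a i i + a j j \<le> dot n x (app n a x) + c" by linarith
  with i j show ?thesis by (intro exI[of _ i] conjI exI[of _ j]) auto
next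
  case False
  then have sign: "0 \<le> x i * x j" if "i < n" "j < n" for i j
    using that by (meson linorder_not_less mult_nonneg_nonneg mult_nonpos_nonpos)
  obtain i where i: "i \<in> {..<n}" and min: "\<And>k. k \<in> {..<n} \<Longrightarrow> a i i \<le> a k k"
    using exists_argmin[of "{..<n}" "\<lambda>i. a i i"] n by (auto simp: lessThan_empty_iff)
  \<comment> \<open>A smallest diagonal entry is bounded by the form at \<open>x\<close>, any other one by \<open>c\<close>, which is
      tested on a standard basis vector.\<close>
  have "a i i * dot n x x \<le> dot n x (app n a x)"
    using nonneg sign min by (intro diag_lower_bound) auto
  then have "a i i \<le> dot n x (app n a x)" using x by simp
  moreover define j where "j = (if i = 0 then 1 else 0 :: nat)"
  have j: "j < n" "j \<noteq> i" using n by (auto simp: j_def)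
  moreover have "a j j \<le> c"
    using bound[of "\<lambda>k. if k = j then 1 else 0"] j
    by (simp add: dot_def app_def if_distrib[of "\<lambda>x. _ * x"] if_distrib[of "\<lambda>x. x * _"] cong: if_cong)
  ultimately show ?thesis using i by (intro exI[of _ i] conjI exI[of _ j]) auto
qed

section \<open>Eigenvalues of real symmetric matrices\<close>

text \<open>
  Here \<open>u + \<i> w\<close> is an eigenvector for \<open>\<alpha> + \<i> \<beta>\<close>, split into real and imaginary parts.
  Comparing \<open>\<langle>w, Au\<rangle>\<close> with \<open>\<langle>u, Aw\<rangle>\<close> forces \<open>\<beta> = 0\<close>, so that \<open>u\<close> and \<open>w\<close> are real
  eigenvectors or zero; a nonzero one is then normalised.
\<close>

lemma rayleigh_of_complex_eigenvector:
  assumes sym: "symmetric_coeffs n a"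
    and u: "\<And>i. i < n \<Longrightarrow> app n a u i = \<alpha> * u i + (- \<beta>) * w i"
    and w: "\<And>i. i < n \<Longrightarrow> app n a w i = \<alpha> * w i + \<beta> * u i"
    and k: "k < n" "u k \<noteq> 0 \<or> w k \<noteq> 0"
  shows "\<exists>x. dot n x x = 1 \<and> dot n x (app n a x) = \<alpha>"
proof -
  have 1: "dot n z (app n a u) = \<alpha> * dot n z u + (- \<beta>) * dot n z w" for z
    using u by (subst dot_lincomb_right[symmetric]) (simp add: dot_def)
  have 2: "dot n z (app n a w) = \<alpha> * dot n z w + \<beta> * dot n z u" for z
    using w by (subst dot_lincomb_right[symmetric]) (simp add: dot_def)
  have pos: "0 < dot n u u + dot n w w"
    using k dot_self_pos[of k n] dot_self_nonneg[of n] 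
    by (metis add_nonneg_pos add_pos_nonneg)
  have "\<beta> * (dot n u u + dot n w w) = 0"
    using 1[of w] 2[of u] dot_app_commute[OF sym, of u w] dot_commute[of n u w]
    by (simp add: algebra_simps)
  with pos have \<beta>: "\<beta> = 0" by simp
  obtain z where z: "0 < dot n z z" "dot n z (app n a z) = \<alpha> * dot n z z"
    using k dot_self_pos[of k n] 1[of u] 2[of w] \<beta> by auto
  define c where "c = 1 / sqrt (dot n z z)"
  have c2: "c\<^sup>2 * dot n z z = 1"
    using z by (simp add: c_def power_divide)
  define x where "x = (\<lambda>i. c * z i)"
  have "dot n x x = c\<^sup>2 * dot n z z" "dot n x (app n a x) = c\<^sup>2 * dot n z (app n a z)"
    by (simp_all add: x_def dot_def app_def sum_distrib_left power2_eq_square algebra_simps)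
  then show ?thesis using c2 z by (intro exI[of _ x]) (simp add: algebra_simps)
qed

lemma char_poly_root_rayleigh:
  fixes A :: "complex mat"
  assumes A: "A \<in> carrier_mat n n"
    and a: "\<And>i j. i < n \<Longrightarrow> j < n \<Longrightarrow> A $$ (i, j) = complex_of_real (a i j)"
    and sym: "symmetric_coeffs n a"
    and root: "poly (char_poly A) k = 0"
  shows "\<exists>x. dot n x x = 1 \<and> dot n x (app n a x) = Re k"
proof -
  from root obtain v where v: "v \<in> carrier_vec n" "v \<noteq> 0\<^sub>v n" "A *\<^sub>v v = k \<cdot>\<^sub>v v"
    using A by (auto simp: eigenvalue_root_char_poly[OF A, symmetric] eigenvalue_def eigenvector_def)
  have eq: "(\<Sum>j<n. complex_of_real (a i j) * v $ j) = k * v $ i" if i: "i < n" for i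
  proof -
    have "(A *\<^sub>v v) $ i = (\<Sum>j<n. A $$ (i, j) * v $ j)"
      using A v(1) i by (auto simp: scalar_prod_def atLeast0LessThan intro!: sum.cong)
    moreover have "(A *\<^sub>v v) $ i = k * v $ i" using v(1) i by (simp add: v(3))
    ultimately show ?thesis using a i by simp
  qed
  from v obtain m where m: "m < n" "v $ m \<noteq> 0"
    by (metis carrier_vecD eq_vecI index_zero_vec(1) index_zero_vec(2))
  show ?thesis
  proof (rule rayleigh_of_complex_eigenvector[OF sym])
    show "app n a (\<lambda>i. Re (v $ i)) i = Re k * Re (v $ i) + (- Im k) * Im (v $ i)"
      if "i < n" for i
      using arg_cong[OF eq[OF that], of Re] by (simp add: app_def)
    show "app n a (\<lambda>i. Im (v $ i)) i = Re k * Im (v $ i) + Im k * Re (v $ i)"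
      if "i < n" for i
      using arg_cong[OF eq[OF that], of Im] by (simp add: app_def)
    show "m < n" "Re (v $ m) \<noteq> 0 \<or> Im (v $ m) \<noteq> 0"
      using m by (auto simp: complex_eq_iff)
  qed
qed

lemma real_eigenvector_char_poly_root:
  fixes A :: "complex mat"
  assumes A: "A \<in> carrier_mat n n"
    and a: "\<And>i j. i < n \<Longrightarrow> j < n \<Longrightarrow> A $$ (i, j) = complex_of_real (a i j)"
    and x: "dot n x x = 1"
    and ev: "\<And>i. i < n \<Longrightarrow> app n a x i = c * x i"
  shows "poly (char_poly A) (complex_of_real c) = 0"
proof -
  define v where "v = vec n (\<lambda>i. complex_of_real (x i))"
  have "v \<noteq> 0\<^sub>v n"
  proof
    assume "v = 0\<^sub>v n"
    then have "complex_of_real (x i) = 0" if "i < n" for i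
      using that unfolding v_def by (metis index_vec index_zero_vec(1))
    then have "dot n x x = 0" by (simp add: dot_def)
    with x show False by simp
  qed
  moreover have "A *\<^sub>v v = complex_of_real c \<cdot>\<^sub>v v"
  proof (rule eq_vecI)
    fix i assume "i < dim_vec (complex_of_real c \<cdot>\<^sub>v v)"
    then have i: "i < n" by (simp add: v_def)
    have "(A *\<^sub>v v) $ i = (\<Sum>j<n. A $$ (i, j) * complex_of_real (x j))"
      using A i by (auto simp: v_def scalar_prod_def atLeast0LessThan intro!: sum.cong)
    also have "\<dots> = complex_of_real (app n a x i)"
      using a i by (simp add: app_def)
    finally show "(A *\<^sub>v v) $ i = (complex_of_real c \<cdot>\<^sub>v v) $ i"
      using ev i by (simp add: v_def)
  qed (use A in \<open>simp add: v_def\<close>)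
  ultimately have "eigenvalue A (complex_of_real c)"
    using A by (auto simp: eigenvalue_def eigenvector_def v_def intro!: exI[of _ v])
  then show ?thesis by (simp add: eigenvalue_root_char_poly[OF A])
qed

section \<open>Trace and eigenvalues\<close>

lemma sum_diag_mult_commute:
  fixes X Y :: "'a :: comm_ring_1 mat"
  assumes "X \<in> carrier_mat n n" "Y \<in> carrier_mat n n"
  shows "(\<Sum>i<n. (X * Y) $$ (i, i)) = (\<Sum>i<n. (Y * X) $$ (i, i))"
proof -
  have "(\<Sum>i<n. (X * Y) $$ (i, i)) = (\<Sum>i<n. \<Sum>j<n. X $$ (i, j) * Y $$ (j, i))"
    using assms by (auto simp: scalar_prod_def atLeast0LessThan intro!: sum.cong)
  also have "\<dots> = (\<Sum>j<n. \<Sum>i<n. X $$ (i, j) * Y $$ (j, i))"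
    by (rule sum.swap)
  also have "\<dots> = (\<Sum>i<n. (Y * X) $$ (i, i))"
    using assms by (auto simp: scalar_prod_def atLeast0LessThan mult.commute intro!: sum.cong)
  finally show ?thesis .
qed

lemma sum_list_diag_mat:
  "A \<in> carrier_mat n n \<Longrightarrow> sum_list (diag_mat A) = (\<Sum>i<n. A $$ (i, i))"
  by (simp add: diag_mat_def sum_list_sum_nth atLeast0LessThan)

text \<open>
  By Schur's decomposition, \<open>A\<close> is similar to a triangular matrix with the eigenvalues on its
  diagonal, and similarity preserves the trace.
\<close>

lemma sum_list_diag_eq_sum_proots:
  fixes A :: "complex mat"
  assumes A: "A \<in> carrier_mat n n"
  shows "sum_list (diag_mat A) = \<Sum>\<^sub># (proots (char_poly A))"
proof -
  obtain es where es: "char_poly A = (\<Prod>e\<leftarrow>es. [:- e, 1:])"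
    using char_poly_factorized[OF A] by blast
  obtain B P Q where "schur_decomposition A es = (B, P, Q)"
    using prod_cases3 by blast
  from schur_decomposition[OF A es this]
  have sim: "similar_mat_wit A B P Q" and diag: "diag_mat B = es" by auto
  note PQ = similar_mat_witD2[OF A sim]
  have "sum_list (diag_mat A) = (\<Sum>i<n. (P * (B * Q)) $$ (i, i))"
    unfolding sum_list_diag_mat[OF A] assoc_mult_mat[OF PQ(6) PQ(5) PQ(7), symmetric] PQ(3)[symmetric] ..
  also have "\<dots> = (\<Sum>i<n. (B * Q * P) $$ (i, i))"
    using PQ by (intro sum_diag_mult_commute) auto
  also have "B * Q * P = B"
    using PQ by (simp add: assoc_mult_mat[of B n n Q n P n])
  finally have "sum_list (diag_mat A) = sum_list es"
    using sum_list_diag_mat[OF PQ(5)] diag by simp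
  moreover have "proots (char_poly A) = mset es"
    unfolding es
  proof (induction es)
    case (Cons e es)
    have "(\<Prod>e\<leftarrow>es. [:- e, 1:]) \<noteq> 0" by (auto simp: prod_list_zero_iff)
    with Cons show ?case by (simp add: proots_mult del: mult_pCons_left)
  qed simp
  ultimately show ?thesis by (simp add: sum_mset_sum_list)
qed

section \<open>Sorted eigenvalues and diagonal entries\<close>

lemma sum_nth_from_1:
  "(\<Sum>i = 1..length xs. (xs ! (i - 1) :: real)) = sum_list xs"
  by (simp add: sum_list_sum_nth sum.atLeast1_atMost_eq atLeast0LessThan)

lemma length_eigval_list:
  fixes A :: "complex mat"
  assumes "A \<in> carrier_mat n n"
  shows "length (sorted_list_of_multiset (image_mset Re (proots (char_poly A)))) = n"
proof -
  have "length (sorted_list_of_multiset (image_mset Re (proots (char_poly A))))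
      = size (mset (sorted_list_of_multiset (image_mset Re (proots (char_poly A)))))"
    by (simp only: size_mset)
  then show ?thesis
    using degree_monic_char_poly[OF assms] by (simp add: size_proots_complex)
qed

lemma sum_mset_image_mset_Re: "\<Sum>\<^sub># (image_mset Re M) = Re (\<Sum>\<^sub># M)"
  by (induction M) auto

lemma sum_eigval:
  fixes A :: "complex mat"
  assumes A: "A \<in> carrier_mat n n"
  shows "(\<Sum>i = 1..n. eigval A i) = Re (\<Sum>\<^sub># (proots (char_poly A)))"
proof -
  let ?M = "proots (char_poly A)"
  let ?L = "sorted_list_of_multiset (image_mset Re ?M)"
  have "(\<Sum>i = 1..n. eigval A i) = sum_list ?L"
    using sum_nth_from_1[of ?L] by (simp add: eigval_def length_eigval_list[OF A])
  also have "\<dots> = \<Sum>\<^sub># (image_mset Re ?M)"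
    by (simp flip: sum_mset_sum_list)
  also have "\<dots> = Re (\<Sum>\<^sub># ?M)"
    by (rule sum_mset_image_mset_Re)
  finally show ?thesis .
qed

lemma sum_sorted_diag:
  assumes "A \<in> carrier_mat n n"
  shows "(\<Sum>i = 1..n. sorted_diag A i) = Re (sum_list (diag_mat A))"
proof -
  let ?xs = "map Re (diag_mat A)"
  have "(\<Sum>i = 1..n. sorted_diag A i) = sum_list (sort ?xs)"
    using sum_nth_from_1[of "sort ?xs"] assms by (simp add: sorted_diag_def diag_mat_def)
  also have "\<dots> = \<Sum>\<^sub># (image_mset Re (mset (diag_mat A)))"
    by (simp flip: sum_mset_sum_list)
  also have "\<dots> = Re (sum_list (diag_mat A))"
    by (simp add: sum_mset_image_mset_Re sum_mset_sum_list)
  finally show ?thesis .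
qed

lemma eigval_first_is_root:
  fixes A :: "complex mat"
  assumes A: "A \<in> carrier_mat n n" and n: "0 < n"
  shows "\<exists>k. poly (char_poly A) k = 0 \<and> Re k = eigval A 1"
proof -
  let ?M = "proots (char_poly A)"
  let ?L = "sorted_list_of_multiset (image_mset Re ?M)"
  have "eigval A 1 \<in> set ?L"
    unfolding eigval_def using n length_eigval_list[OF A] by (intro nth_mem) simp
  then have "eigval A 1 \<in> Re ` set_mset ?M" by simp
  moreover have "char_poly A \<noteq> 0" using degree_monic_char_poly[OF A] by auto
  ultimately show ?thesis by auto
qed

lemma root_le_eigval_last:
  fixes A :: "complex mat"
  assumes A: "A \<in> carrier_mat n n" and root: "poly (char_poly A) k = 0"
  shows "Re k \<le> eigval A n"
proof -
  let ?M = "proots (char_poly A)"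
  let ?L = "sorted_list_of_multiset (image_mset Re ?M)"
  have "char_poly A \<noteq> 0" using degree_monic_char_poly[OF A] by auto
  with root have "Re k \<in> set ?L" by simp
  then obtain m where m: "m < n" "?L ! m = Re k"
    by (metis in_set_conv_nth length_eigval_list[OF A])
  have "?L ! m \<le> ?L ! (n - 1)"
    using m(1) length_eigval_list[OF A] by (intro sorted_nth_mono) auto
  with m show ?thesis by (simp add: eigval_def)
qed

text \<open>
  The sorting permutation sends \<open>i\<close> and \<open>j\<close> to different positions, so one of the two positions
  is not the first.
\<close>

lemma sort_two_smallest_le:
  fixes xs :: "'a :: linordered_ab_group_add list"
  assumes "i < length xs" "j < length xs" "i \<noteq> j"
  shows "sort xs ! 0 + sort xs ! 1 \<le> xs ! i + xs ! j"
proof -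
  obtain f where f: "bij_betw f {..<length xs} {..<length (sort xs)}"
    and nth: "\<And>i. i < length xs \<Longrightarrow> xs ! i = sort xs ! f i"
    using permutation_Ex_bij[of xs "sort xs"] by auto
  have le: "f i < length xs" "f j < length xs"
    using f assms by (auto dest!: bij_betwE)
  have "f i \<noteq> f j"
    using f assms by (auto simp: bij_betw_def inj_on_def)
  then consider "1 \<le> f i" | "1 \<le> f j" by linarith
  then show ?thesis
  proof cases
    case 1
    then have "sort xs ! 1 \<le> sort xs ! f i" "sort xs ! 0 \<le> sort xs ! f j"
      using le by (auto intro!: sorted_nth_mono)
    then show ?thesis using nth assms add_mono by (metis add.commute)
  next
    case 2
    then have "sort xs ! 1 \<le> sort xs ! f j" "sort xs ! 0 \<le> sort xs ! f i"
      using le by (auto intro!: sorted_nth_mono)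
    then show ?thesis using nth assms by (simp add: add_mono)
  qed
qed

section \<open>The eigenvalue inequalities\<close>

theorem lemma2p1:
  fixes n :: nat and A :: "complex mat"
  assumes "n \<ge> 2"
    and "A \<in> carrier_mat n n"
    and "nonnegative_mat A"
    and "symmetric_mat A"
  shows "(\<Sum>i = 2..n - 1. eigval A i) \<le> (\<Sum>i = 3..n. sorted_diag A i)
    \<and> eigval A 1 + eigval A n \<ge> sorted_diag A 1 + sorted_diag A 2"
proof -
  note n = assms(1) and A = assms(2)
  define a where "a i j = Re (A $$ (i, j))" for i j
  have ge0: "0 \<le> A $$ (i, j)" if "i < n" "j < n" for i j
    using assms that by (auto simp: nonnegative_mat_def)
  then have nonneg: "0 \<le> a i j" if "i < n" "j < n" for i j
    using that by (auto simp: a_def less_eq_complex_def)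
  have a: "A $$ (i, j) = complex_of_real (a i j)" if "i < n" "j < n" for i j
    using ge0[OF that] by (simp add: a_def less_eq_complex_def complex_eq_iff)
  have sym: "symmetric_coeffs n a"
    unfolding symmetric_coeffs_def a_def
    using assms by (metis symmetric_mat_def carrier_matD index_transpose_mat(1))
  obtain y where y: "dot n y y = 1"
    and max: "\<And>z. dot n z (app n a z) \<le> dot n y (app n a y) * dot n z z"
    using rayleigh_attains_max[of n a] n by auto
  have "poly (char_poly A) (complex_of_real (dot n y (app n a y))) = 0"
    using rayleigh_max_eigenvector[OF sym y max refl]
    by (intro real_eigenvector_char_poly_root[OF A a y])
  from root_le_eigval_last[OF A this]
  have last: "dot n y (app n a y) \<le> eigval A n" by simp
  obtain k where k: "poly (char_poly A) k = 0" "Re k = eigval A 1"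
    using eigval_first_is_root[OF A] n by auto
  obtain x where x: "dot n x x = 1" "dot n x (app n a x) = eigval A 1"
    using char_poly_root_rayleigh[OF A a sym k(1)] k(2) by auto
  obtain i j where ij: "i < n" "j < n" "i \<noteq> j"
    and le: "a i i + a j j \<le> eigval A 1 + dot n y (app n a y)"
    using two_diag_entries_le[OF sym n nonneg max x(1)] x(2) by auto
  have "sorted_diag A 1 + sorted_diag A 2 \<le> a i i + a j j"
    using sort_two_smallest_le[of i "map Re (diag_mat A)" j] ij A
    by (simp add: sorted_diag_def diag_mat_def a_def)
  with le last have second: "sorted_diag A 1 + sorted_diag A 2 \<le> eigval A 1 + eigval A n"
    by linarith
  \<comment> \<open>The first inequality is the second one subtracted from the two expressions for the trace.\<close>
  have "{1..n} = insert 1 (insert n {2..n - 1})" using n by auto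
  then have "(\<Sum>i = 1..n. eigval A i) = eigval A 1 + eigval A n + (\<Sum>i = 2..n - 1. eigval A i)"
    using n by simp
  moreover have "{1..n} = insert 1 (insert 2 {3..n})" using n by auto
  then have "(\<Sum>i = 1..n. sorted_diag A i)
      = sorted_diag A 1 + sorted_diag A 2 + (\<Sum>i = 3..n. sorted_diag A i)"
    by simp
  moreover have "(\<Sum>i = 1..n. eigval A i) = (\<Sum>i = 1..n. sorted_diag A i)"
    by (simp only: sum_eigval[OF A] sum_sorted_diag[OF A] sum_list_diag_eq_sum_proots[OF A])
  ultimately show ?thesis using second by linarith
qed

end
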